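(* Let $G=(U,V,E)$, $w:E\to\mathbb{R}$ with $w_{ij}>0$ for all $(i,j)\in E$, be a degenerate assignment game, i.e. one having more than one maximum weight matching. Then: (1) viable players are treated by core imputations in the same way as subpar players, namely they are never paid: if $q\in U\cup V$ is viable or subpar, then $y_q=0$ for every imputation $y$ in the core; (2) viable teams are treated by core imputations in the same way as essential teams, namely they are always fairly paid: if $e=(i,j)\in E$ is viable or essential, then $y_i+y_j=w_e$ for every imputation $y$ in the core.
   Context: Assignment game: $G=(U,V,E)$ is a finite bipartite graph with bipartition $U,V$ and edge weights $w_{ij}>0$. The players are the vertices $U\cup V$, and the teams are the edges. The worth $p(S_u\cup S_v)$ of a coalition $S_u\cup S_v$ ($S_u\subseteq U$, $S_v\subseteq V$) is the weight of a maximum weight matching in the subgraph of $G$ induced on $S_u\cup S_v$. An imputation is a function $y:U\cup V\to\mathbb{R}_{\ge 0}$ with $\sum_{q\in U\cup V}y_q=p(U\cup V)$. It is in the core if $\sum_{q\in S_u\cup S_v}y_q\ge p(S_u\cup S_v)$ for every coalition. A player (respectively, team) is essential if it is matched in (respectively, belongs to) every maximum weight matching in $G$; viable if it is matched in (belongs to) some maximum weight matching but not in (to) some other one; subpar if it is matched in (belongs to) no maximum weight matching. *)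

theory Defs
  imports Complex_Main
begin

locale assignment_game =
  fixes U V :: "'a set" and E :: "('a \<times> 'a) set" and w :: "'a \<times> 'a \<Rightarrow> real"
  assumes finite_U: "finite U" and finite_V: "finite V"
    and disjoint_UV: "U \<inter> V = {}"
    and edges: "E \<subseteq> U \<times> V"
    and weight_pos: "\<And>e. e \<in> E \<Longrightarrow> w e > 0"

text \<open>An edge is a pair with its first component in \<open>U\<close> and its second in \<open>V\<close>. As the two
  sides are disjoint, injectivity of both projections says that no vertex lies on two edges.\<close>

definition matching :: "('a \<times> 'a) set \<Rightarrow> ('a \<times> 'a) set \<Rightarrow> bool" where
  "matching E M \<longleftrightarrow> M \<subseteq> E \<and> inj_on fst M \<and> inj_on snd M"

definition matched :: "('a \<times> 'a) set \<Rightarrow> 'a \<Rightarrow> bool" where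
  "matched M q \<longleftrightarrow> (\<exists>(i, j)\<in>M. q = i \<or> q = j)"

definition max_weight_matching ::
    "('a \<times> 'a) set \<Rightarrow> ('a \<times> 'a \<Rightarrow> real) \<Rightarrow> ('a \<times> 'a) set \<Rightarrow> bool" where
  "max_weight_matching E w M \<longleftrightarrow>
     matching E M \<and> (\<forall>N. matching E N \<longrightarrow> sum w N \<le> sum w M)"

definition worth ::
    "('a \<times> 'a) set \<Rightarrow> ('a \<times> 'a \<Rightarrow> real) \<Rightarrow> 'a set \<Rightarrow> 'a set \<Rightarrow> real" where
  "worth E w Su Sv = Max (sum w ` {M. matching (E \<inter> Su \<times> Sv) M})"

lemma worth_eq_weight:
  assumes "finite E" "max_weight_matching (E \<inter> Su \<times> Sv) w M"
  shows "worth E w Su Sv = sum w M"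
proof -
  have "finite {M. matching (E \<inter> Su \<times> Sv) M}"
    by (rule finite_subset[of _ "Pow E"]) (auto simp: matching_def assms(1))
  then show ?thesis
    unfolding worth_def using assms(2)
    by (intro Max_eqI) (auto simp: max_weight_matching_def)
qed

definition imputation ::
    "'a set \<Rightarrow> 'a set \<Rightarrow> ('a \<times> 'a) set \<Rightarrow> ('a \<times> 'a \<Rightarrow> real) \<Rightarrow> ('a \<Rightarrow> real) \<Rightarrow> bool" where
  "imputation U V E w y \<longleftrightarrow>
     (\<forall>q\<in>U \<union> V. 0 \<le> y q) \<and> (\<Sum>q\<in>U \<union> V. y q) = worth E w U V"

definition core ::
    "'a set \<Rightarrow> 'a set \<Rightarrow> ('a \<times> 'a) set \<Rightarrow> ('a \<times> 'a \<Rightarrow> real) \<Rightarrow> ('a \<Rightarrow> real) set" where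
  "core U V E w = {y. imputation U V E w y \<and>
     (\<forall>Su Sv. Su \<subseteq> U \<longrightarrow> Sv \<subseteq> V \<longrightarrow> worth E w Su Sv \<le> (\<Sum>q\<in>Su \<union> Sv. y q))}"

definition degenerate :: "('a \<times> 'a) set \<Rightarrow> ('a \<times> 'a \<Rightarrow> real) \<Rightarrow> bool" where
  "degenerate E w \<longleftrightarrow>
     (\<exists>M N. max_weight_matching E w M \<and> max_weight_matching E w N \<and> M \<noteq> N)"

definition essential_player :: "('a \<times> 'a) set \<Rightarrow> ('a \<times> 'a \<Rightarrow> real) \<Rightarrow> 'a \<Rightarrow> bool" where
  "essential_player E w q \<longleftrightarrow> (\<forall>M. max_weight_matching E w M \<longrightarrow> matched M q)"

definition viable_player :: "('a \<times> 'a) set \<Rightarrow> ('a \<times> 'a \<Rightarrow> real) \<Rightarrow> 'a \<Rightarrow> bool" where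
  "viable_player E w q \<longleftrightarrow>
     (\<exists>M. max_weight_matching E w M \<and> matched M q) \<and>
     (\<exists>M. max_weight_matching E w M \<and> \<not> matched M q)"

definition subpar_player :: "('a \<times> 'a) set \<Rightarrow> ('a \<times> 'a \<Rightarrow> real) \<Rightarrow> 'a \<Rightarrow> bool" where
  "subpar_player E w q \<longleftrightarrow> (\<forall>M. max_weight_matching E w M \<longrightarrow> \<not> matched M q)"

definition essential_team ::
    "('a \<times> 'a) set \<Rightarrow> ('a \<times> 'a \<Rightarrow> real) \<Rightarrow> 'a \<times> 'a \<Rightarrow> bool" where
  "essential_team E w e \<longleftrightarrow> (\<forall>M. max_weight_matching E w M \<longrightarrow> e \<in> M)"

definition viable_team ::
    "('a \<times> 'a) set \<Rightarrow> ('a \<times> 'a \<Rightarrow> real) \<Rightarrow> 'a \<times> 'a \<Rightarrow> bool" where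
  "viable_team E w e \<longleftrightarrow>
     (\<exists>M. max_weight_matching E w M \<and> e \<in> M) \<and>
     (\<exists>M. max_weight_matching E w M \<and> e \<notin> M)"

definition subpar_team ::
    "('a \<times> 'a) set \<Rightarrow> ('a \<times> 'a \<Rightarrow> real) \<Rightarrow> 'a \<times> 'a \<Rightarrow> bool" where
  "subpar_team E w e \<longleftrightarrow> (\<forall>M. max_weight_matching E w M \<longrightarrow> e \<notin> M)"

end

theory Submission
  imports Defs
begin

text \<open>Complementary slackness. A core imputation \<open>y\<close> covers every edge, by the core condition for
  two-player coalitions. Hence, for a maximum weight matching \<open>M\<close>, the total \<open>y (U \<union> V)\<close> exceeds
  \<open>w M\<close> by a sum of nonnegative terms: the slacks of the edges of \<open>M\<close> and the pay of the players
  that \<open>M\<close> leaves unmatched. As \<open>y (U \<union> V) = w M\<close>, all these terms vanish, so it suffices to choose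
  an \<open>M\<close> that misses the given player, or one that contains the given team.\<close>

lemma finite_matchings:
  assumes "finite E"
  shows "finite {M. matching E M}"
  by (rule finite_subset[of _ "Pow E"]) (auto simp: matching_def assms)

context assignment_game
begin

lemma finite_E: "finite E"
  using edges finite_U finite_V by (meson finite_SigmaI finite_subset)

lemma core_nonneg: "y \<in> core U V E w \<Longrightarrow> q \<in> U \<union> V \<Longrightarrow> 0 \<le> y q"
  by (auto simp: core_def imputation_def)

lemma core_edge_cover:
  assumes y: "y \<in> core U V E w" and e: "(i, j) \<in> E"
  shows "w (i, j) \<le> y i + y j"
proof -
  have ij: "i \<in> U" "j \<in> V" "i \<noteq> j"
    using e edges disjoint_UV by auto
  have "w (i, j) = sum w {(i, j)}"
    by simp
  \<comment> \<open>The edge alone is a matching of the subgraph induced on its two endpoints, so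
    its weight is among the values over which \<open>worth\<close> takes the maximum.\<close>
  also have "\<dots> \<le> worth E w {i} {j}"
    unfolding worth_def
    using e finite_E by (intro Max_ge finite_imageI finite_matchings imageI) (auto simp: matching_def)
  also have "\<dots> \<le> (\<Sum>q\<in>{i} \<union> {j}. y q)"
    using y ij(1,2) unfolding core_def by blast
  also have "\<dots> = y i + y j"
    using ij by simp
  finally show ?thesis .
qed

lemma core_sum_eq_weight:
  assumes "y \<in> core U V E w" and "max_weight_matching E w M"
  shows "(\<Sum>q\<in>U \<union> V. y q) = sum w M"
proof -
  \<comment> \<open>\<open>worth\<close> restricts to edges inside the coalition; the grand
    coalition keeps all of \<open>E\<close>, so \<open>M\<close> is optimal for it.\<close>
  have "E \<inter> U \<times> V = E"
    using edges by blast
  then show ?thesis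
    using assms worth_eq_weight[OF finite_E, of U V w M] by (simp add: core_def imputation_def)
qed

text \<open>No player lies on two edges of \<open>M\<close>: injectivity of \<open>fst\<close> and
  \<open>snd\<close> excludes this within a side, disjointness of \<open>U\<close> and
  \<open>V\<close> across sides. So the sum over edges counts each matched player exactly
  once.\<close>

lemma sum_players_matching:
  fixes y :: "'a \<Rightarrow> real"
  assumes "matching E M"
  shows "(\<Sum>q\<in>U \<union> V. y q) =
    (\<Sum>e\<in>M. y (fst e) + y (snd e)) + (\<Sum>q\<in>{q \<in> U \<union> V. \<not> matched M q}. y q)"
proof -
  have M: "M \<subseteq> U \<times> V" "inj_on fst M" "inj_on snd M"
    using assms edges by (auto simp: matching_def)
  have fin: "finite M"
    using M(1) finite_U finite_V by (meson finite_SigmaI finite_subset)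
  have "{q. matched M q} = fst ` M \<union> snd ` M"
    by (force simp: matched_def)
  moreover have "fst ` M \<inter> snd ` M = {}"
    using M(1) disjoint_UV by fastforce
  ultimately have "(\<Sum>q | matched M q. y q) = (\<Sum>e\<in>M. y (fst e) + y (snd e))"
    using M fin by (simp add: sum.union_disjoint sum.reindex sum.distrib)
  moreover have "{q. matched M q} \<subseteq> U \<union> V"
    using M(1) by (auto simp: matched_def)
  moreover have "(U \<union> V) - {q. matched M q} = {q \<in> U \<union> V. \<not> matched M q}"
    by blast
  ultimately show ?thesis
    using sum.subset_diff[of "{q. matched M q}" "U \<union> V" y] finite_U finite_V by simp
qed

lemma core_complementary_slackness:
  assumes y: "y \<in> core U V E w" and M: "max_weight_matching E w M"
  shows "(i, j) \<in> M \<Longrightarrow> y i + y j = w (i, j)"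
    and "q \<in> U \<union> V \<Longrightarrow> \<not> matched M q \<Longrightarrow> y q = 0"
proof -
  define slack where "slack e = y (fst e) + y (snd e) - w e" for e
  define Q where "Q = {q \<in> U \<union> V. \<not> matched M q}"
  have mat: "matching E M"
    using M by (simp add: max_weight_matching_def)
  then have sub: "M \<subseteq> E"
    by (simp add: matching_def)
  have fin: "finite M" "finite Q"
    using sub finite_E finite_U finite_V by (auto simp: Q_def intro: finite_subset)
  have slack: "0 \<le> slack e" if "e \<in> M" for e
    using core_edge_cover[OF y, of "fst e" "snd e"] that sub by (auto simp: slack_def)
  have pay: "0 \<le> y q" if "q \<in> Q" for q
    using core_nonneg[OF y] that by (auto simp: Q_def)
  \<comment> \<open>Equate the two expressions for the total pay: \<open>sum w M\<close>, and its
    split along \<open>M\<close>.\<close>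
  have "sum slack M + sum y Q = 0"
    using core_sum_eq_weight[OF y M] sum_players_matching[OF mat, of y]
    by (simp add: slack_def Q_def sum_subtractf)
  then have "sum slack M = 0" "sum y Q = 0"
    using sum_nonneg[of M slack] sum_nonneg[of Q y] slack pay by auto
  then have zero: "\<forall>e\<in>M. slack e = 0" "\<forall>q\<in>Q. y q = 0"
    using sum_nonneg_eq_0_iff[of M slack] sum_nonneg_eq_0_iff[of Q y] slack pay fin by auto
  show "(i, j) \<in> M \<Longrightarrow> y i + y j = w (i, j)"
    using zero(1) by (force simp: slack_def)
  show "q \<in> U \<union> V \<Longrightarrow> \<not> matched M q \<Longrightarrow> y q = 0"
    using zero(2) by (auto simp: Q_def)
qed

end

theorem corollary3:
  fixes U V :: "'a set" and E :: "('a \<times> 'a) set" and w :: "'a \<times> 'a \<Rightarrow> real"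
  assumes "assignment_game U V E w"
    and "degenerate E w"
  shows "(\<forall>q\<in>U \<union> V. viable_player E w q \<or> subpar_player E w q \<longrightarrow>
            (\<forall>y\<in>core U V E w. y q = 0)) \<and>
         (\<forall>(i, j)\<in>E. viable_team E w (i, j) \<or> essential_team E w (i, j) \<longrightarrow>
            (\<forall>y\<in>core U V E w. y i + y j = w (i, j)))"
proof -
  interpret assignment_game U V E w
    by fact
  \<comment> \<open>Being subpar or essential is a universal statement about maximum weight
    matchings, so those two cases need some matching to apply it to; degeneracy supplies
    one.\<close>
  obtain M where M: "max_weight_matching E w M"
    using assms(2) by (auto simp: degenerate_def)
  have "y q = 0"
    if q: "q \<in> U \<union> V" "viable_player E w q \<or> subpar_player E w q" and y: "y \<in> core U V E w" for q y
  proof -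
    obtain N where "max_weight_matching E w N" "\<not> matched N q"
      using q(2) M by (auto simp: viable_player_def subpar_player_def)
    then show ?thesis
      using core_complementary_slackness(2) q(1) y by blast
  qed
  moreover have "y i + y j = w (i, j)"
    if e: "viable_team E w (i, j) \<or> essential_team E w (i, j)" and y: "y \<in> core U V E w" for i j y
  proof -
    obtain N where "max_weight_matching E w N" "(i, j) \<in> N"
      using e M by (auto simp: viable_team_def essential_team_def)
    then show ?thesis
      using core_complementary_slackness(1) y by blast
  qed
  ultimately show ?thesis
    by blast
qed

end
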